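(* Let $G$ be a finite non-abelian simple group. Let $M$ be a maximal subgroup of $G$ and let $H$ be a normal subgroup of $M$ of prime index in $M$. Then $G = \langle H, H^g\rangle$ for some $g \in G$.
   Context: For a subgroup $H$ of $G$ and $g\in G$, $H^g = g^{-1}Hg$. *)

theory Defs
  imports "HOL-Algebra.SimpleGroups" "HOL-Algebra.Generated_Groups"
begin

definition maximal_subgroup :: "'a set \<Rightarrow> ('a, 'b) monoid_scheme \<Rightarrow> bool" where
  "maximal_subgroup M G \<longleftrightarrow>
     subgroup M G \<and> M \<noteq> carrier G \<and>
     (\<forall>K. subgroup K G \<longrightarrow> M \<subseteq> K \<longrightarrow> K = M \<or> K = carrier G)"

(* The convention is H^g = g^-1 H g, not g H g^-1. *)
definition conj_subgroup :: "('a, 'b) monoid_scheme \<Rightarrow> 'a set \<Rightarrow> 'a \<Rightarrow> 'a set" where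
  "conj_subgroup G H g = (inv\<^bsub>G\<^esub> g) <#\<^bsub>G\<^esub> (H #>\<^bsub>G\<^esub> g)"

definition subgroup_index :: "('a, 'b) monoid_scheme \<Rightarrow> 'a set \<Rightarrow> nat" where
  "subgroup_index G H = card (rcosets\<^bsub>G\<^esub> H)"

end

theory Submission
  imports Defs "HOL-Algebra.FiniteProduct" "HOL-Algebra.Multiplicative_Group"
begin

text \<open>
  The engine of the proof is the transfer homomorphism from \<open>G\<close> to \<open>M/H\<close>, which is abelian because
  its order is prime. As \<open>G\<close> is simple and non-abelian, the transfer is trivial. Choose \<open>x\<close> in
  \<open>M - H\<close> for which the least \<open>n > 0\<close> with \<open>x\<^sup>n = 1\<close> is as small as possible, and evaluate the
  transfer at \<open>x\<close> along the cycles of \<open>x\<close> on the right cosets of \<open>M\<close>: a cycle of length \<open>r\<close> through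
  the coset \<open>Mt\<close> contributes the class of \<open>t x\<^sup>r t\<inverse>\<close> (\<open>transfer_eq_hom\<close>). For \<open>r > 1\<close> this
  element is killed by the smaller exponent \<open>n/r\<close>, so the choice of \<open>x\<close> puts it into \<open>H\<close>. The coset
  \<open>M\<close> itself contributes the class of \<open>x\<close>, which is not trivial. Since the total is trivial, some
  fixed coset \<open>Mg \<noteq> M\<close> must contribute non-trivially: there is a \<open>g\<close> outside \<open>M\<close> such that both \<open>x\<close>
  and \<open>y = g x g\<inverse>\<close> lie in \<open>M\<close> but not in \<open>H\<close> (\<open>fusion_outside_kernel\<close>).

  This \<open>g\<close> is the required element. Because the index of \<open>H\<close> is prime, \<open>H\<close> together with any element
  of \<open>M - H\<close> generates \<open>M\<close>. If \<open>H\<^sup>g\<close> were contained in \<open>M\<close>, then \<open>M\<close> would contain the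
  \<open>g\<close>-conjugates of \<open>H\<close> and of \<open>y\<close>, hence \<open>M\<^sup>g\<close>; but a maximal subgroup of a simple group is its own
  normalizer unless it is trivial, so \<open>g\<close> would lie in \<open>M\<close>. So \<open>H\<^sup>g\<close> is not contained in \<open>M\<close>. Now
  \<open>x\<close> normalizes \<open>H\<close>, and it normalizes \<open>H\<^sup>g\<close> because \<open>y\<close> normalizes \<open>H\<close>. Hence the normalizer of
  \<open>N = \<langle>H, H\<^sup>g\<rangle>\<close> contains \<open>H\<close> and \<open>x\<close>, thus all of \<open>M\<close>, and it also contains \<open>H\<^sup>g\<close>; by
  maximality it is \<open>G\<close>. So \<open>N\<close> is normal and non-trivial, which in a simple group means \<open>N = G\<close>.
\<close>

section \<open>Products over the cycles of a permutation\<close>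

lemma (in group) inv_mult_cancel_left:
  assumes "a \<in> carrier G" "z \<in> carrier G"
  shows "a \<otimes> (inv a \<otimes> z) = z" "inv a \<otimes> (a \<otimes> z) = z"
  using assms by (simp_all flip: m_assoc)

text \<open>
  The set splits into cycles of \<open>\<sigma>\<close>, and removing the cycle of one point leaves a smaller
  \<open>\<sigma>\<close>-invariant set, so induction on the cardinality applies. The common period \<open>n\<close> makes \<open>\<sigma>\<close>
  invertible on the set, and every cycle length divides \<open>n\<close>; the divisibility is what
  the minimality argument for the transfer relies on.
\<close>

lemma (in comm_monoid) finprod_eq_one_by_cycles:
  assumes "finite S" "0 < n" "\<And>s. s \<in> S \<Longrightarrow> \<sigma> s \<in> S" "\<And>s. s \<in> S \<Longrightarrow> (\<sigma> ^^ n) s = s"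
    and "f \<in> S \<rightarrow> carrier G"
    and "\<And>s r. \<lbrakk>s \<in> S; 0 < r; r dvd n; (\<sigma> ^^ r) s = s\<rbrakk>
           \<Longrightarrow> (\<Otimes>i\<in>{..<r}. f ((\<sigma> ^^ i) s)) = \<one>"
  shows "finprod G f S = \<one>"
  using assms
proof (induction "card S" arbitrary: S rule: less_induct)
  case less
  note fin = less.prems(1) and n = less.prems(2) and step = less.prems(3)
    and per = less.prems(4) and f = less.prems(5) and cyc = less.prems(6)
  show ?case
  proof (cases "S = {}")
    case True
    then show ?thesis by simp
  next
    case False
    then obtain s where s: "s \<in> S" by blast
    \<comment> \<open>the length of the cycle through \<open>s\<close>; the cycle itself is \<open>C\<close>\<close>
    define r where "r = (LEAST r. 0 < r \<and> (\<sigma> ^^ r) s = s)"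
    have r: "0 < r" "(\<sigma> ^^ r) s = s"
      using LeastI[of "\<lambda>r. 0 < r \<and> (\<sigma> ^^ r) s = s" n] n per[OF s] by (auto simp: r_def)
    have least: "r \<le> k" if "0 < k" "(\<sigma> ^^ k) s = s" for k
      using Least_le[of "\<lambda>r. 0 < r \<and> (\<sigma> ^^ r) s = s" k] that by (auto simp: r_def)
    have modr: "(\<sigma> ^^ (m mod r)) s = (\<sigma> ^^ m) s" for m
      by (rule funpow_mod_eq) (rule r(2))
    have "n mod r = 0"
      using least[of "n mod r"] modr[of n] per[OF s] r(1) by (metis mod_less_divisor not_less not_gr_zero)
    then have dvd: "r dvd n" by auto
    define C where "C = (\<lambda>i. (\<sigma> ^^ i) s) ` {..<r}"
    have orb: "(\<sigma> ^^ m) s \<in> C" for m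
    proof -
      have "m mod r < r" using r(1) by simp
      then show ?thesis unfolding C_def by (metis modr imageI lessThan_iff)
    qed
    have in_S: "(\<sigma> ^^ m) s \<in> S" for m
      by (induction m) (auto simp: s step)
    have CS: "C \<subseteq> S" using in_S by (auto simp: C_def)
    have ne: "(\<sigma> ^^ i) s \<noteq> (\<sigma> ^^ j) s" if "i < j" "j < r" for i j
    proof
      assume eq: "(\<sigma> ^^ i) s = (\<sigma> ^^ j) s"
      have rn: "r \<le> n" using dvd n by (rule dvd_imp_le)
      have "s = (\<sigma> ^^ (n - i + i)) s" using per[OF s] that rn by simp
      also have "\<dots> = (\<sigma> ^^ (n - i + j)) s" unfolding funpow_add o_apply using eq by simp
      also have "n - i + j = (j - i) + n" using that rn by simp
      also have "(\<sigma> ^^ ((j - i) + n)) s = (\<sigma> ^^ (j - i)) s"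
        by (simp add: funpow_add per[OF s])
      finally have "(\<sigma> ^^ (j - i)) s = s" by simp
      then show False using least[of "j - i"] that by simp
    qed
    have inj: "inj_on (\<lambda>i. (\<sigma> ^^ i) s) {..<r}"
      by (rule inj_onI) (metis lessThan_iff ne nat_neq_iff)
    have rest: "finprod G f (S - C) = \<one>"
    proof (rule less.hyps)
      have "s \<in> C" using orb[of 0] by simp
      then show "card (S - C) < card S" using s fin by (intro psubset_card_mono) auto
      show "\<sigma> t \<in> S - C" if t: "t \<in> S - C" for t
      proof -
        have "t \<in> C" if "\<sigma> t \<in> C"
        proof -
          obtain i where i: "\<sigma> t = (\<sigma> ^^ i) s" using \<open>\<sigma> t \<in> C\<close> by (auto simp: C_def)
          \<comment> \<open>the power \<open>n - 1\<close> of \<open>\<sigma>\<close> is its inverse, and it preserves the cycle\<close>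
          have "t = (\<sigma> ^^ Suc (n - 1)) t" using per[of t] t n by simp
          also have "\<dots> = (\<sigma> ^^ (n - 1)) (\<sigma> t)" by (simp only: funpow_Suc_right o_apply)
          also have "\<dots> = (\<sigma> ^^ (n - 1 + i)) s" by (simp add: i funpow_add)
          finally show ?thesis using orb by metis
        qed
        then show ?thesis using t step by blast
      qed
    qed (use fin n per f cyc in auto)
    have onC: "finprod G f C = (\<Otimes>i\<in>{..<r}. f ((\<sigma> ^^ i) s))"
      unfolding C_def by (rule finprod_reindex) (use inj f in_S in auto)
    have "finprod G f (C \<union> (S - C)) = finprod G f C \<otimes> finprod G f (S - C)"
      by (rule finprod_Un_disjoint) (use fin CS f in \<open>auto intro: finite_subset\<close>)
    moreover have "C \<union> (S - C) = S" using CS by blast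
    ultimately show ?thesis using rest onC cyc[OF s r(1) dvd r(2)] by simp
  qed
qed

section \<open>The transfer homomorphism\<close>

text \<open>
  The transfer of a homomorphism \<open>\<phi>\<close> from a subgroup \<open>M\<close> of finite index to an abelian group \<open>A\<close>.
  The function \<open>T\<close> is a transversal: it picks a representative of every right coset.
\<close>

locale group_transfer = group G + A: comm_group A
  for G :: "('a, 'b) monoid_scheme" (structure) and M :: "'a set" and A :: "('c, 'd) monoid_scheme" and \<phi> and T +
  assumes sub: "subgroup M G"
    and fin_index: "finite (rcosets M)"
    and hom: "\<phi> \<in> hom (G\<lparr>carrier := M\<rparr>) A"
    and representative: "c \<in> rcosets M \<Longrightarrow> T c \<in> c"
begin

text \<open>
  The representative of \<open>c\<close> times \<open>x\<close> lies in the coset \<open>c x\<close>, and \<open>cocycle x c\<close> is the element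
  of \<open>M\<close> by which it differs from the chosen representative of that coset.
\<close>

definition cocycle where "cocycle x c = T c \<otimes> x \<otimes> inv (T (c #> x))"

definition transfer where "transfer x = (\<Otimes>\<^bsub>A\<^esub>c\<in>rcosets M. \<phi> (cocycle x c))"

lemma M_carrier: "M \<subseteq> carrier G"
  using sub by (rule subgroup.subset)

lemma coset_carrier: "c \<in> rcosets M \<Longrightarrow> c \<subseteq> carrier G"
  using subgroup.rcosets_carrier[OF sub is_group] .

lemma T_carrier: "c \<in> rcosets M \<Longrightarrow> T c \<in> carrier G"
  using coset_carrier representative by blast

lemma coset_T: "c \<in> rcosets M \<Longrightarrow> c = M #> T c"
  unfolding RCOSETS_def using representative repr_independence[OF _ _ sub]
  by (auto simp: RCOSETS_def)

lemma shift_coset: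
  assumes "c \<in> rcosets M" "x \<in> carrier G"
  shows "c #> x = M #> (T c \<otimes> x)" "c #> x \<in> rcosets M"
proof -
  show "c #> x = M #> (T c \<otimes> x)"
    using coset_mult_assoc[OF M_carrier T_carrier assms(2)] coset_T assms(1) by metis
  then show "c #> x \<in> rcosets M"
    using assms T_carrier M_carrier by (simp add: rcosetsI)
qed

lemma cocycle_in_M:
  assumes "c \<in> rcosets M" "x \<in> carrier G"
  shows "cocycle x c \<in> M"
proof -
  have "T (c #> x) \<in> M #> (T c \<otimes> x)"
    using representative[OF shift_coset(2)[OF assms]] shift_coset(1)[OF assms] by simp
  then have "M #> (T c \<otimes> x) = M #> T (c #> x)"
    using repr_independence[OF _ _ sub] T_carrier assms by simp
  then have "T c \<otimes> x \<in> M #> T (c #> x)"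
    using rcos_self[OF _ sub] T_carrier assms by (metis m_closed)
  then show ?thesis
    unfolding cocycle_def
    using subgroup.rcos_module_imp[OF sub is_group] T_carrier[OF shift_coset(2)[OF assms]] by simp
qed

lemma \<phi>_closed: "a \<in> M \<Longrightarrow> \<phi> a \<in> carrier A"
  using hom by (auto simp: hom_def)

lemma \<phi>_mult: "a \<in> M \<Longrightarrow> b \<in> M \<Longrightarrow> \<phi> (a \<otimes> b) = \<phi> a \<otimes>\<^bsub>A\<^esub> \<phi> b"
  using hom by (auto simp: hom_def)

lemma \<phi>_one: "\<phi> \<one> = \<one>\<^bsub>A\<^esub>"
  using hom_one[OF hom] subgroup.subgroup_is_group[OF sub is_group] A.is_group by simp

lemma cocycle_mult:
  assumes "c \<in> rcosets M" "x \<in> carrier G" "y \<in> carrier G"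
  shows "cocycle (x \<otimes> y) c = cocycle x c \<otimes> cocycle y (c #> x)"
proof -
  have c': "c #> x \<in> rcosets M" and c'': "c #> (x \<otimes> y) \<in> rcosets M"
    using shift_coset(2) assms by auto
  have "c #> x #> y = c #> (x \<otimes> y)"
    using coset_mult_assoc coset_carrier assms by simp
  then show ?thesis
    using assms T_carrier[OF c'] T_carrier[OF c''] T_carrier[OF assms(1)]
    by (simp add: cocycle_def m_assoc inv_mult_cancel_left)
qed

lemma shift_inj: "x \<in> carrier G \<Longrightarrow> inj_on (\<lambda>c. c #> x) (rcosets M)"
  by (rule inj_onI) (metis coset_mult_inv2 coset_mult_assoc coset_carrier inv_closed r_inv coset_mult_one)

lemma shift_image:
  assumes "x \<in> carrier G"
  shows "(\<lambda>c. c #> x) ` (rcosets M) = rcosets M"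
  by (rule endo_inj_surj[OF fin_index _ shift_inj[OF assms]]) (use shift_coset(2) assms in auto)

text \<open>
  The values of the cocycle at \<open>x\<close> and \<open>y\<close> multiply to that at \<open>x y\<close>, except that the second one is
  taken at the shifted coset; the shift is a permutation of the cosets, so it disappears in the
  product over all of them.
\<close>

lemma transfer_hom: "transfer \<in> hom G A"
proof (rule homI)
  fix x assume x: "x \<in> carrier G"
  show "transfer x \<in> carrier A"
    unfolding transfer_def by (rule A.finprod_closed) (use cocycle_in_M x \<phi>_closed in auto)
  fix y assume y: "y \<in> carrier G"
  have "transfer (x \<otimes> y) = (\<Otimes>\<^bsub>A\<^esub>c\<in>rcosets M. \<phi> (cocycle x c) \<otimes>\<^bsub>A\<^esub> \<phi> (cocycle y (c #> x)))"
    unfolding transfer_def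
    by (rule A.finprod_cong') (auto simp: cocycle_mult x y \<phi>_mult \<phi>_closed cocycle_in_M shift_coset(2))
  also have "\<dots> = transfer x \<otimes>\<^bsub>A\<^esub> (\<Otimes>\<^bsub>A\<^esub>c\<in>rcosets M. \<phi> (cocycle y (c #> x)))"
    unfolding transfer_def
    by (rule A.finprod_multf) (auto simp: x y \<phi>_closed cocycle_in_M shift_coset(2))
  also have "(\<Otimes>\<^bsub>A\<^esub>c\<in>rcosets M. \<phi> (cocycle y (c #> x))) = transfer y"
    unfolding transfer_def
    using A.finprod_reindex[of "\<lambda>c. \<phi> (cocycle y c)" "\<lambda>c. c #> x" "rcosets M"]
      shift_inj[OF x] shift_image[OF x] by (auto simp: y \<phi>_closed cocycle_in_M)
  finally show "transfer (x \<otimes> y) = transfer x \<otimes>\<^bsub>A\<^esub> transfer y" .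
qed

lemma funpow_shift:
  assumes "c \<in> rcosets M" "x \<in> carrier G"
  shows "((\<lambda>c. c #> x) ^^ i) c = c #> (x [^] (i::nat))"
  using assms by (induction i) (auto simp: coset_carrier coset_mult_assoc)

text \<open>
  By the cocycle identity the product along the orbit of a coset under \<open>x\<close> telescopes.
\<close>

lemma finprod_cocycle_pow:
  assumes "c \<in> rcosets M" "x \<in> carrier G"
  shows "(\<Otimes>\<^bsub>A\<^esub>i\<in>{..<r}. \<phi> (cocycle x (c #> (x [^] (i::nat))))) = \<phi> (cocycle (x [^] r) c)"
proof (induction r)
  case 0
  have "cocycle \<one> c = \<one>"
    using assms T_carrier by (simp add: cocycle_def coset_carrier)
  then show ?case by (simp add: \<phi>_one)
next
  case (Suc r)
  have cl: "\<phi> (cocycle x (c #> (x [^] (i::nat)))) \<in> carrier A" for i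
    using assms by (simp add: \<phi>_closed cocycle_in_M shift_coset(2))
  have "(\<Otimes>\<^bsub>A\<^esub>i\<in>{..<Suc r}. \<phi> (cocycle x (c #> (x [^] (i::nat)))))
      = \<phi> (cocycle x (c #> (x [^] r))) \<otimes>\<^bsub>A\<^esub> \<phi> (cocycle (x [^] r) c)"
    using cl Suc by (simp add: lessThan_Suc)
  also have "\<dots> = \<phi> (cocycle (x [^] r) c) \<otimes>\<^bsub>A\<^esub> \<phi> (cocycle x (c #> (x [^] r)))"
    using assms by (simp add: A.m_comm \<phi>_closed cocycle_in_M shift_coset(2))
  also have "\<dots> = \<phi> (cocycle (x [^] Suc r) c)"
    using assms by (simp add: cocycle_mult \<phi>_mult cocycle_in_M shift_coset(2))
  finally show ?case .
qed

lemma M_coset: "M \<in> rcosets M"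
  using subgroup.subgroup_in_rcosets[OF sub is_group] .

text \<open>
  A cycle of \<open>x\<close> of length \<open>r\<close> through the coset of \<open>t\<close> contributes \<open>\<phi> (t x\<^sup>r t\<inverse>)\<close> to the
  transfer. The coset \<open>M\<close> is a fixed point contributing \<open>\<phi> x\<close>, since \<open>A\<close> is abelian; the hypothesis
  silences all the other cycles.
\<close>

lemma transfer_eq_hom:
  assumes x: "x \<in> M" and n: "0 < n" "x [^] (n::nat) = \<one>"
    and triv: "\<And>t r. \<lbrakk>t \<in> carrier G; t \<notin> M; 0 < r; r dvd n; t \<otimes> x [^] (r::nat) \<otimes> inv t \<in> M\<rbrakk>
       \<Longrightarrow> \<phi> (t \<otimes> x [^] r \<otimes> inv t) = \<one>\<^bsub>A\<^esub>"
  shows "transfer x = \<phi> x"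
proof -
  have xG: "x \<in> carrier G" using x M_carrier by blast
  have Mx: "M #> x = M" using coset_join2[OF xG sub x] .
  define R where "R = rcosets M - {M}"
  have RM: "rcosets M = insert M R" "M \<notin> R" "finite R"
    using M_coset fin_index by (auto simp: R_def)
  have "(\<Otimes>\<^bsub>A\<^esub>c\<in>R. \<phi> (cocycle x c)) = \<one>\<^bsub>A\<^esub>"
  proof (rule A.finprod_eq_one_by_cycles[where \<sigma> = "\<lambda>c. c #> x" and n = n])
    show "c #> x \<in> R" if "c \<in> R" for c
      using that shift_coset(2)[OF _ xG] inj_onD[OF shift_inj[OF xG], of c M] Mx M_coset
      by (auto simp: R_def)
    show "((\<lambda>c. c #> x) ^^ n) c = c" if "c \<in> R" for c
      using that xG n by (simp add: R_def funpow_shift coset_carrier)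
    show "(\<lambda>c. \<phi> (cocycle x c)) \<in> R \<rightarrow> carrier A"
      by (auto simp: R_def xG cocycle_in_M \<phi>_closed)
    show "(\<Otimes>\<^bsub>A\<^esub>i\<in>{..<r}. \<phi> (cocycle x (((\<lambda>c. c #> x) ^^ i) c))) = \<one>\<^bsub>A\<^esub>"
      if c: "c \<in> R" and r: "0 < r" "r dvd n" "((\<lambda>c. c #> x) ^^ r) c = c" for c r
    proof -
      have cM: "c \<in> rcosets M" "c \<noteq> M" using c by (auto simp: R_def)
      have fix_c: "c #> (x [^] r) = c" using r(3) cM xG by (simp add: funpow_shift)
      have coc: "cocycle (x [^] r) c = T c \<otimes> x [^] r \<otimes> inv (T c)"
        by (simp add: cocycle_def fix_c)
      have "T c \<notin> M"
        using cM coset_T coset_join2[OF T_carrier sub] by metis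
      moreover have "T c \<otimes> x [^] r \<otimes> inv (T c) \<in> M"
        using cocycle_in_M[OF cM(1), of "x [^] r"] xG coc by simp
      ultimately have "\<phi> (cocycle (x [^] r) c) = \<one>\<^bsub>A\<^esub>"
        using triv T_carrier cM r coc by simp
      then show ?thesis
        using finprod_cocycle_pow[OF cM(1) xG, of r] by (simp add: funpow_shift cM xG)
    qed
  qed (use RM n in auto)
  moreover have "transfer x = \<phi> (cocycle x M) \<otimes>\<^bsub>A\<^esub> (\<Otimes>\<^bsub>A\<^esub>c\<in>R. \<phi> (cocycle x c))"
    unfolding transfer_def RM(1)
    by (rule A.finprod_insert) (use RM M_coset in \<open>auto simp: R_def xG cocycle_in_M \<phi>_closed\<close>)
  moreover have "\<phi> (cocycle x M) = \<phi> x"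
  proof -
    have TM: "T M \<in> M" "inv (T M) \<in> M"
      using representative[OF M_coset] subgroup.m_inv_closed[OF sub] by auto
    have "\<phi> (cocycle x M) = \<phi> (T M) \<otimes>\<^bsub>A\<^esub> \<phi> x \<otimes>\<^bsub>A\<^esub> \<phi> (inv (T M))"
      using TM x by (simp add: cocycle_def Mx \<phi>_mult subgroup.m_closed[OF sub])
    also have "\<dots> = \<phi> x \<otimes>\<^bsub>A\<^esub> (\<phi> (T M) \<otimes>\<^bsub>A\<^esub> \<phi> (inv (T M)))"
      using TM x by (metis A.m_comm A.m_assoc \<phi>_closed)
    also have "\<phi> (T M) \<otimes>\<^bsub>A\<^esub> \<phi> (inv (T M)) = \<one>\<^bsub>A\<^esub>"
      using TM M_carrier by (metis \<phi>_mult \<phi>_one r_inv subsetD)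
    finally show ?thesis using x by (simp add: \<phi>_closed)
  qed
  ultimately show ?thesis using x by (simp add: \<phi>_closed)
qed

end

section \<open>Fusion outside a subgroup\<close>

lemma (in group) conj_pow:
  assumes "t \<in> carrier G" "x \<in> carrier G"
  shows "(t \<otimes> x \<otimes> inv t) [^] (k::nat) = t \<otimes> x [^] k \<otimes> inv t"
proof (induction k)
  case 0
  then show ?case using assms by simp
next
  case (Suc k)
  then show ?case using assms by (simp add: m_assoc inv_mult_cancel_left)
qed

text \<open>
  If no homomorphism from \<open>G\<close> to \<open>A\<close> is non-trivial, then neither is the transfer, so the
  contribution of the coset \<open>M\<close> has to be cancelled by that of another cycle. Choosing
  \<open>x\<close> outside the kernel with the smallest possible exponent rules out cycles of length \<open>r > 1\<close>,
  as their contribution comes from a conjugate of \<open>x\<^sup>r\<close>, which has a smaller exponent.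
\<close>

lemma (in group) fusion_outside_kernel:
  assumes fin: "finite (carrier G)" and sub: "subgroup M G" and A: "comm_group A"
    and hom: "\<phi> \<in> hom (G\<lparr>carrier := M\<rparr>) A"
    and nontriv: "\<exists>x\<in>M. \<phi> x \<noteq> \<one>\<^bsub>A\<^esub>"
    and perfect: "\<And>h x. \<lbrakk>h \<in> hom G A; x \<in> carrier G\<rbrakk> \<Longrightarrow> h x = \<one>\<^bsub>A\<^esub>"
  obtains g x where "g \<in> carrier G" "g \<notin> M" "x \<in> M" "\<phi> x \<noteq> \<one>\<^bsub>A\<^esub>"
    "g \<otimes> x \<otimes> inv g \<in> M" "\<phi> (g \<otimes> x \<otimes> inv g) \<noteq> \<one>\<^bsub>A\<^esub>"
proof -
  have MG: "M \<subseteq> carrier G" using sub by (rule subgroup.subset)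
  define P where "P n \<longleftrightarrow> 0 < n \<and> (\<exists>x\<in>M. \<phi> x \<noteq> \<one>\<^bsub>A\<^esub> \<and> x [^] n = \<one>)" for n :: nat
  have "P (order G)"
    using nontriv MG fin pow_order_eq_1 order_gt_0_iff_finite unfolding P_def by blast
  then have "P (Least P)" by (rule LeastI)
  then obtain x n where x: "x \<in> M" "\<phi> x \<noteq> \<one>\<^bsub>A\<^esub>" "x [^] n = \<one>" "0 < n" and nP: "n = Least P"
    unfolding P_def by blast
  have xG: "x \<in> carrier G" using x MG by blast
  interpret group_transfer G M A \<phi> "\<lambda>c. SOME y. y \<in> c"
  proof (intro group_transfer.intro group_transfer_axioms.intro)
    show "finite (rcosets M)" using fin by (simp add: RCOSETS_def)
    show "(SOME y. y \<in> c) \<in> c" if "c \<in> rcosets M" for c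
      using subgroup.rcosets_non_empty[OF sub that] by (simp add: some_in_eq)
  qed (use A sub hom is_group in auto)
  have "transfer x \<noteq> \<phi> x"
    using perfect[OF transfer_hom xG] x by simp
  then obtain t r where t: "t \<in> carrier G" "t \<notin> M" "0 < r" "r dvd n"
     and tM: "t \<otimes> x [^] (r::nat) \<otimes> inv t \<in> M" "\<phi> (t \<otimes> x [^] r \<otimes> inv t) \<noteq> \<one>\<^bsub>A\<^esub>"
    using transfer_eq_hom[OF x(1) x(4) x(3)] by blast
  have "P (n div r)"
  proof -
    have "(t \<otimes> x [^] r \<otimes> inv t) [^] (n div r) = t \<otimes> x [^] (r * (n div r)) \<otimes> inv t"
      using t xG by (simp add: conj_pow nat_pow_pow)
    also have "\<dots> = \<one>" using t x by simp
    finally show ?thesis unfolding P_def using tM t x(4) by (auto simp: dvd_div_eq_0_iff intro!: bexI)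
  qed
  then have "n \<le> n div r" unfolding nP by (rule Least_le)
  then have "r = 1" using t(3) x(4) by (metis div_less_dividend less_one nat_neq_iff not_less)
  then show thesis using that[of t x] t tM x xG by simp
qed

lemma (in simple_group) hom_to_comm_group_trivial:
  assumes "\<not> comm_group G" "comm_group A" "h \<in> hom G A" "x \<in> carrier G"
  shows "h x = \<one>\<^bsub>A\<^esub>"
proof -
  interpret A: comm_group A by fact
  interpret h: group_hom G A h by unfold_locales fact
  from no_real_normal_subgroup[OF h.normal_kernel] show ?thesis
  proof
    assume "kernel G A h = carrier G"
    then show ?thesis using assms(4) by (auto simp: kernel_def)
  next
    assume "kernel G A h = {\<one>}"
    then have inj: "inj_on h (carrier G)" by (rule h.trivial_ker_imp_inj)
    have "comm_group G"
    proof (rule group_comm_groupI)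
      fix x y assume "x \<in> carrier G" "y \<in> carrier G"
      then show "x \<otimes> y = y \<otimes> x"
        by (intro inj_onD[OF inj]) (auto simp: A.m_comm)
    qed
    then show ?thesis using assms(1) by contradiction
  qed
qed

section \<open>Subgroups of prime index\<close>

lemma (in group) subgroup_above_prime_index:
  assumes fin: "finite (carrier G)" and H: "subgroup H G" and K: "subgroup K G"
    and "H \<subseteq> K" "prime (card (rcosets H))" "K \<noteq> H"
  shows "K = carrier G"
proof -
  let ?K = "G\<lparr>carrier := K\<rparr>"
  have KG: "group ?K" using K by (rule subgroup.subgroup_is_group) (rule is_group)
  have "subgroup H ?K" using subgroup_incl[OF H K assms(4)] .
  then have 1: "card (rcosets\<^bsub>?K\<^esub> H) * card H = card K"
    using group.lagrange[OF KG] by (simp add: order_def)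
  have 2: "card (rcosets H) * card H = card (carrier G)"
    using lagrange[OF H] by (simp add: order_def)
  have 3: "card (rcosets K) * card K = card (carrier G)"
    using lagrange[OF K] by (simp add: order_def)
  have KfG: "K \<subseteq> carrier G" "finite K" using K fin subgroup.subset finite_subset by metis+
  have "finite H" using KfG assms(4) finite_subset by blast
  then have H0: "card H > 0" using H subgroup.one_closed by (metis card_gt_0_iff empty_iff)
  have "card (rcosets K) * card (rcosets\<^bsub>?K\<^esub> H) = card (rcosets H)"
    using 1 2 3 H0 by (metis mult.assoc mult_right_cancel less_not_refl)
  then have "card (rcosets\<^bsub>?K\<^esub> H) = 1 \<or> card (rcosets\<^bsub>?K\<^esub> H) = card (rcosets H)"
    using assms(5) by (metis prime_nat_iff dvd_triv_right)
  then show ?thesis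
  proof
    assume "card (rcosets\<^bsub>?K\<^esub> H) = 1"
    then have "card H = card K" using 1 by simp
    then show ?thesis using assms(4,6) KfG card_subset_eq by metis
  next
    assume "card (rcosets\<^bsub>?K\<^esub> H) = card (rcosets H)"
    then have "card K = card (carrier G)" using 1 2 by simp
    then show ?thesis using KfG fin card_subset_eq by metis
  qed
qed

text \<open>
  The trivial subgroup has prime index, so every non-trivial element generates the group.
\<close>

lemma (in group) prime_order_imp_comm_group:
  assumes "prime (order G)"
  shows "comm_group G"
proof -
  have fin: "finite (carrier G)"
    using prime_gt_0_nat[OF assms] order_gt_0_iff_finite by simp
  have "card (carrier G) \<noteq> 1" using assms by (auto simp: order_def)
  then obtain a where a: "a \<in> carrier G" "a \<noteq> \<one>"
    using card_1_singleton_iff[of "carrier G"] one_closed by auto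
  have trivial: "subgroup {\<one>} G" by (rule triv_subgroup)
  have "card (rcosets {\<one>}) = order G"
    using lagrange[OF trivial] by simp
  moreover have "subgroup (generate G {a}) G" using a by (intro generate_is_subgroup) simp
  moreover have "a \<in> generate G {a}" by (simp add: generate.incl)
  ultimately have "generate G {a} = carrier G"
    using a(2) assms subgroup.one_closed
    by (intro subgroup_above_prime_index[OF fin trivial]) auto
  then have gen: "\<exists>k::int. x = a [^] k" if "x \<in> carrier G" for x
    using generate_pow[OF a(1)] that by blast
  show ?thesis
  proof (rule group_comm_groupI)
    fix x y assume "x \<in> carrier G" "y \<in> carrier G"
    then obtain k l :: int where "x = a [^] k" "y = a [^] l" using gen by blast
    then show "x \<otimes> y = y \<otimes> x" using int_pow_mult[OF a(1)] by (metis add.commute)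
  qed
qed

section \<open>Normalizers\<close>

text \<open>
  The normalizer of \<open>N\<close>, described by the inclusion of the conjugate of \<open>N\<close> in \<open>N\<close>. Closure under
  inverses depends on finiteness: conjugation is then a permutation of \<open>N\<close>.
\<close>

lemma (in group) subgroup_conj_stabilizer:
  assumes fin: "finite N" and N: "N \<subseteq> carrier G"
  shows "subgroup {a \<in> carrier G. \<forall>y\<in>N. inv a \<otimes> y \<otimes> a \<in> N} G" (is "subgroup ?S G")
proof (rule subgroupI)
  show "?S \<noteq> {}" using N by (auto intro!: exI[of _ \<one>])
next
  fix a assume a: "a \<in> ?S"
  have inj: "inj_on (\<lambda>y. inv a \<otimes> y \<otimes> a) N"
  proof (rule inj_onI)
    fix y z assume "y \<in> N" "z \<in> N" "inv a \<otimes> y \<otimes> a = inv a \<otimes> z \<otimes> a"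
    then show "y = z" using a N by (auto simp: subset_iff)
  qed
  have "(\<lambda>y. inv a \<otimes> y \<otimes> a) ` N = N"
    by (rule endo_inj_surj[OF fin _ inj]) (use a in auto)
  then have "\<exists>z\<in>N. y = inv a \<otimes> z \<otimes> a" if "y \<in> N" for y using that by blast
  moreover have "inv (inv a) \<otimes> (inv a \<otimes> z \<otimes> a) \<otimes> inv a = z" if "z \<in> N" for z
    using a N that by (simp add: m_assoc inv_mult_cancel_left subset_iff)
  ultimately have "inv (inv a) \<otimes> y \<otimes> inv a \<in> N" if "y \<in> N" for y using that by metis
  then show "inv a \<in> ?S" using a by blast
next
  fix a b assume ab: "a \<in> ?S" "b \<in> ?S"
  have "inv (a \<otimes> b) \<otimes> y \<otimes> (a \<otimes> b) = inv b \<otimes> (inv a \<otimes> y \<otimes> a) \<otimes> b" if "y \<in> N" for y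
    using ab N that by (auto simp: m_assoc inv_mult_group subset_iff)
  then show "a \<otimes> b \<in> ?S" using ab by auto
qed auto

lemma (in group) normal_if_conj_stabilizer:
  assumes "subgroup N G" "carrier G \<subseteq> {a \<in> carrier G. \<forall>y\<in>N. inv a \<otimes> y \<otimes> a \<in> N}"
  shows "N \<lhd> G"
  unfolding normal_inv_iff
proof (intro conjI ballI)
  fix a y assume "a \<in> carrier G" "y \<in> N"
  then have "inv (inv a) \<otimes> y \<otimes> inv a \<in> N" using assms(2) inv_closed by blast
  then show "a \<otimes> y \<otimes> inv a \<in> N" using \<open>a \<in> carrier G\<close> by simp
qed (rule assms(1))

lemma (in group) conj_generate:
  assumes S: "S \<subseteq> carrier G" and x: "x \<in> carrier G"
    and conj: "\<And>s. s \<in> S \<Longrightarrow> inv x \<otimes> s \<otimes> x \<in> generate G S"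
    and y: "y \<in> generate G S"
  shows "inv x \<otimes> y \<otimes> x \<in> generate G S"
  using y
proof induction
  case one
  then show ?case using x by (simp add: generate.one)
next
  case (incl s)
  then show ?case by (rule conj)
next
  case (inv s)
  then have "inv x \<otimes> inv s \<otimes> x = inv (inv x \<otimes> s \<otimes> x)"
    using x S by (auto simp: inv_mult_group m_assoc subset_iff)
  then show ?case using conj[OF inv] generate_m_inv_closed[OF S] by simp
next
  case (eng a b)
  then have "a \<in> carrier G" "b \<in> carrier G" using generate_in_carrier[OF S] by auto
  then have "inv x \<otimes> (a \<otimes> b) \<otimes> x = (inv x \<otimes> a \<otimes> x) \<otimes> (inv x \<otimes> b \<otimes> x)"
    using x by (simp add: m_assoc inv_mult_cancel_left)
  then show ?case using eng generate.eng by metis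
qed

text \<open>
  By maximality the normalizer of \<open>M\<close> is either \<open>M\<close> or \<open>G\<close>, and in the second case \<open>M\<close> would be a
  proper non-trivial normal subgroup of \<open>G\<close>.
\<close>

lemma (in simple_group) maximal_subgroup_self_normalizing:
  assumes fin: "finite (carrier G)" and max: "maximal_subgroup M G" and "M \<noteq> {\<one>}"
    and g: "g \<in> carrier G" "\<And>y. y \<in> M \<Longrightarrow> inv g \<otimes> y \<otimes> g \<in> M"
  shows "g \<in> M"
proof -
  let ?S = "{a \<in> carrier G. \<forall>y\<in>M. inv a \<otimes> y \<otimes> a \<in> M}"
  have M: "subgroup M G" "M \<noteq> carrier G"
    and above: "\<And>K. subgroup K G \<Longrightarrow> M \<subseteq> K \<Longrightarrow> K = M \<or> K = carrier G"
    using max by (auto simp: maximal_subgroup_def)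
  note MG = subgroup.subset[OF M(1)]
  have "subgroup ?S G"
    by (rule subgroup_conj_stabilizer) (use MG fin finite_subset in auto)
  moreover have "M \<subseteq> ?S"
    using MG by (auto intro!: subgroup.m_closed[OF M(1)] subgroup.m_inv_closed[OF M(1)])
  moreover have "?S \<noteq> carrier G"
  proof
    assume "?S = carrier G"
    then have "M \<lhd> G" using normal_if_conj_stabilizer[OF M(1)] by simp
    then show False using no_real_normal_subgroup M assms(3) by blast
  qed
  ultimately have "?S = M" using above by blast
  then show ?thesis using g by blast
qed

section \<open>Generation by two conjugates\<close>

lemma (in group) mem_conj_subgroup:
  assumes "H \<subseteq> carrier G" "g \<in> carrier G"
  shows "y \<in> conj_subgroup G H g \<longleftrightarrow> (\<exists>h\<in>H. y = inv g \<otimes> h \<otimes> g)"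
proof -
  have "inv g \<otimes> (h \<otimes> g) = inv g \<otimes> h \<otimes> g" if "h \<in> H" for h
    using assms that by (auto simp: m_assoc subset_iff)
  then show ?thesis unfolding conj_subgroup_def l_coset_def r_coset_def by fastforce
qed

text \<open>
  The fusion lemma is applied to the projection of \<open>M\<close> onto \<open>M/H\<close>. Any \<open>g\<close> outside \<open>M\<close> works as soon
  as it conjugates some element of \<open>M - H\<close> into \<open>M - H\<close>.
\<close>

lemma (in simple_group) generated_by_two_conjugates:
  assumes fin: "finite (carrier G)" and nonabelian: "\<not> comm_group G"
    and max: "maximal_subgroup M G" and normal: "H \<lhd> (G\<lparr>carrier := M\<rparr>)"
    and prime: "prime (subgroup_index (G\<lparr>carrier := M\<rparr>) H)"
  shows "\<exists>g \<in> carrier G. carrier G = generate G (H \<union> conj_subgroup G H g)"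
proof -
  let ?M = "G\<lparr>carrier := M\<rparr>"
  have M: "subgroup M G"
    and above: "\<And>K. subgroup K G \<Longrightarrow> M \<subseteq> K \<Longrightarrow> K = M \<or> K = carrier G"
    using max by (auto simp: maximal_subgroup_def)
  note MG = subgroup.subset[OF M]
  interpret M: group ?M using M by (rule subgroup.subgroup_is_group) (rule is_group)
  interpret H: normal H ?M by fact
  have HM: "H \<subseteq> M" using H.subset by simp
  have HG: "H \<subseteq> carrier G" using HM MG by blast
  have Hsub: "subgroup H G"
    using incl_subgroup[OF M H.is_subgroup] .
  have conjH: "inv m \<otimes> h \<otimes> m \<in> H" if "m \<in> M" "h \<in> H" for m h
    using H.inv_op_closed1[of m h] that M by (simp add: m_inv_consistent)
  \<comment> \<open>\<open>H\<close> and an element of \<open>M - H\<close> generate \<open>M\<close>, because the index is prime\<close>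
  have full: "M \<subseteq> L" if L: "subgroup L G" "H \<subseteq> L" "y \<in> L" "y \<in> M" "y \<notin> H" for L y
  proof -
    have "L \<inter> M = carrier ?M"
    proof (rule M.subgroup_above_prime_index[OF _ H.is_subgroup])
      show "subgroup (L \<inter> M) ?M"
        using subgroup_incl[OF subgroups_Inter_pair[OF L(1) M] M] by simp
    qed (use prime fin MG L HM in \<open>auto simp: subgroup_index_def intro: finite_subset\<close>)
    then show ?thesis by auto
  qed

  define Q where "Q = ?M Mod H"
  have "order Q = subgroup_index ?M H"
    by (simp add: Q_def order_def FactGroup_def subgroup_index_def)
  moreover have "group Q" unfolding Q_def by (rule H.factorgroup_is_group)
  ultimately have Q: "comm_group Q"
    using prime group.prime_order_imp_comm_group by metis
  have hom: "(\<lambda>a. H #> a) \<in> hom ?M Q"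
    using H.r_coset_hom_Mod by (simp add: Q_def)
  have ker: "H #> a = \<one>\<^bsub>Q\<^esub> \<longleftrightarrow> a \<in> H" if "a \<in> M" for a
    using that MG Hsub coset_join1[OF _ _ Hsub] coset_join2[OF _ Hsub] by (auto simp: Q_def)
  have "H \<noteq> M"
  proof
    assume "H = M"
    then have "subgroup_index ?M H = 1"
      using M.lagrange[OF H.is_subgroup] M.order_gt_0_iff_finite finite_subset[OF MG fin]
      by (auto simp: subgroup_index_def order_def)
    then show False using prime by simp
  qed
  then obtain m where "m \<in> M" "m \<notin> H" using HM by blast
  then have "\<exists>x\<in>M. H #> x \<noteq> \<one>\<^bsub>Q\<^esub>" using ker by blast
  then obtain g x where g: "g \<in> carrier G" "g \<notin> M"
    and "x \<in> M" "H #> x \<noteq> \<one>\<^bsub>Q\<^esub>" "g \<otimes> x \<otimes> inv g \<in> M" "H #> (g \<otimes> x \<otimes> inv g) \<noteq> \<one>\<^bsub>Q\<^esub>"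
    using fusion_outside_kernel[OF fin M Q hom] hom_to_comm_group_trivial[OF nonabelian Q] by metis
  moreover define y where "y = g \<otimes> x \<otimes> inv g"
  ultimately have x: "x \<in> M" "x \<notin> H" and y: "y \<in> M" "y \<notin> H" using ker by auto
  have xG: "x \<in> carrier G" and yG: "y \<in> carrier G" using x y MG by auto
  have "M \<noteq> {\<one>}" using x H.one_closed by auto

  let ?Hg = "conj_subgroup G H g"
  note in_Hg = mem_conj_subgroup[OF HG g(1)]
  have HgG: "?Hg \<subseteq> carrier G" using HG g by (auto simp: in_Hg subset_iff)
  have Hg_M: "\<not> ?Hg \<subseteq> M"
  proof
    assume Hg: "?Hg \<subseteq> M"
    \<comment> \<open>The elements conjugated into \<open>M\<close> by \<open>g\<close>: among them are \<open>H\<close> by assumption and \<open>y\<close>,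
      since its conjugate is \<open>x\<close>. So \<open>g\<close> normalizes \<open>M\<close>.\<close>
    define L where "L = {a \<in> carrier G. inv g \<otimes> a \<otimes> g \<in> M}"
    have "subgroup L G"
    proof (rule subgroupI)
      have "\<one> \<in> L" using g subgroup.one_closed[OF M] by (simp add: L_def)
      then show "L \<noteq> {}" by blast
      show "inv a \<in> L" if "a \<in> L" for a
      proof -
        have "inv g \<otimes> inv a \<otimes> g = inv (inv g \<otimes> a \<otimes> g)"
          using that g by (simp add: L_def inv_mult_group m_assoc)
        then show ?thesis using that subgroup.m_inv_closed[OF M] by (simp add: L_def)
      qed
      show "a \<otimes> b \<in> L" if "a \<in> L" "b \<in> L" for a b
      proof -
        have "inv g \<otimes> (a \<otimes> b) \<otimes> g = (inv g \<otimes> a \<otimes> g) \<otimes> (inv g \<otimes> b \<otimes> g)"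
          using that g by (simp add: L_def m_assoc inv_mult_cancel_left)
        then show ?thesis using that subgroup.m_closed[OF M] by (simp add: L_def)
      qed
    qed (auto simp: L_def)
    moreover have "H \<subseteq> L" using Hg HG in_Hg by (fastforce simp: L_def)
    moreover have "y \<in> L"
      using x xG g yG by (simp add: L_def y_def m_assoc inv_mult_cancel_left)
    ultimately have "M \<subseteq> L" using full y by blast
    then have "g \<in> M"
      by (intro maximal_subgroup_self_normalizing[OF fin max \<open>M \<noteq> {\<one>}\<close> g(1)]) (auto simp: L_def)
    then show False using g by blast
  qed

  define N where "N = generate G (H \<union> ?Hg)"
  have gens: "H \<union> ?Hg \<subseteq> carrier G" using HG HgG by blast
  have N: "subgroup N G" unfolding N_def using generate_is_subgroup[OF gens] .
  have gens_N: "H \<union> ?Hg \<subseteq> N" unfolding N_def by (auto intro: generate.incl)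
  note NG = subgroup.subset[OF N]
  \<comment> \<open>the normalizer of \<open>N\<close>\<close>
  define S where "S = {a \<in> carrier G. \<forall>y\<in>N. inv a \<otimes> y \<otimes> a \<in> N}"
  have S: "subgroup S G"
    unfolding S_def using subgroup_conj_stabilizer[OF finite_subset[OF NG fin] NG] .
  have "inv a \<otimes> y \<otimes> a \<in> N" if "a \<in> N" "y \<in> N" for a y
    using that N by (simp add: subgroup.m_closed subgroup.m_inv_closed)
  then have "N \<subseteq> S" using NG by (auto simp: S_def)
  then have HS: "H \<union> ?Hg \<subseteq> S" using gens_N by (rule subset_trans[rotated])
  have "x \<in> S"
  proof -
    have "inv x \<otimes> s \<otimes> x \<in> H \<union> ?Hg" if "s \<in> H \<union> ?Hg" for s
      using that
    proof
      assume "s \<in> ?Hg"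
      then obtain h where h: "h \<in> H" "s = inv g \<otimes> h \<otimes> g" using in_Hg by blast
      have hG: "h \<in> carrier G" using h HG by blast
      \<comment> \<open>\<open>g x = y g\<close>, so conjugating \<open>H\<^sup>g\<close> by \<open>x\<close> amounts to conjugating \<open>H\<close> by \<open>y\<close>\<close>
      have "inv x \<otimes> s \<otimes> x = inv g \<otimes> (inv y \<otimes> h \<otimes> y) \<otimes> g"
        using h(2) hG g xG by (simp add: y_def m_assoc inv_mult_group inv_mult_cancel_left)
      then show ?thesis using in_Hg conjH[OF y(1) h(1)] by blast
    qed (use conjH x in simp)
    then have "inv x \<otimes> s \<otimes> x \<in> N" if "s \<in> H \<union> ?Hg" for s
      using that gens_N by blast
    then have "inv x \<otimes> n \<otimes> x \<in> N" if "n \<in> N" for n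
      using conj_generate[OF gens xG] that unfolding N_def by blast
    then show ?thesis using xG by (simp add: S_def)
  qed
  then have "M \<subseteq> S" using full[OF S] HS x by simp
  moreover have "S \<noteq> M" using HS Hg_M by blast
  ultimately have "S = carrier G" using above[OF S] by blast
  then have "N \<lhd> G" using normal_if_conj_stabilizer[OF N] by (simp add: S_def)
  moreover have "N \<noteq> {\<one>}"
    using Hg_M gens_N subgroup.one_closed[OF M] by blast
  ultimately have "N = carrier G" using no_real_normal_subgroup by blast
  then show ?thesis using g by (auto simp: N_def)
qed

theorem corollary1:
  fixes G :: "('a, 'b) monoid_scheme" and M H :: "'a set"
  assumes "simple_group G"
    and "finite (carrier G)"
    and "\<not> comm_group G"
    and "maximal_subgroup M G"
    and "H \<lhd> (G\<lparr>carrier := M\<rparr>)"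
    and "prime (subgroup_index (G\<lparr>carrier := M\<rparr>) H)"
  shows "\<exists>g \<in> carrier G. carrier G = generate G (H \<union> conj_subgroup G H g)"
  using assms simple_group.generated_by_two_conjugates by metis

end
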